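(* Let $J$ be an almost complex structure on a real $3$-Bihom-Lie algebra $(L,[\cdot,\cdot,\cdot],\alpha,\beta)$. If $$J[x,y,z]=-[Jx,Jy,Jz]\quad\text{for all }x,y,z\in L,$$ then $J$ is a complex structure on $L$.
   Context: A real $3$-Bihom-Lie algebra is a $4$-tuple $(L,[\cdot,\cdot,\cdot],\alpha,\beta)$ consisting of a real vector space $L$, a $3$-linear map $[\cdot,\cdot,\cdot]\colon L\times L\times L\to L$ and two linear maps $\alpha,\beta\colon L\to L$ such that for all $x,y,z,u,v\in L$: (1) $\alpha\beta=\beta\alpha$; (2) $\alpha([x,y,z])=[\alpha(x),\alpha(y),\alpha(z)]$ and $\beta([x,y,z])=[\beta(x),\beta(y),\beta(z)]$; (3) $[\beta(x),\beta(y),\alpha(z)]=-[\beta(y),\beta(x),\alpha(z)]=-[\beta(x),\beta(z),\alpha(y)]$; (4) $[\beta^2(u),\beta^2(v),[\beta(x),\beta(y),\alpha(z)]]=[\beta^2(y),\beta^2(z),[\beta(u),\beta(v),\alpha(x)]]-[\beta^2(x),\beta^2(z),[\beta(u),\beta(v),\alpha(y)]]+[\beta^2(x),\beta^2(y),[\beta(u),\beta(v),\alpha(z)]]$. An almost complex structure on $L$ is a linear map $J\colon L\to L$ with $J^2=-\mathrm{Id}$, $J\alpha=\alpha J$ and $J\beta=\beta J$. It is a complex structure if for all $x,y,z\in L$, $$J[x,y,z]=-[Jx,Jy,Jz]+[Jx,y,z]+[x,Jy,z]+[x,y,Jz]+J[Jx,Jy,z]+J[x,Jy,Jz]+J[Jx,y,Jz].$$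 *)

theory Defs
  imports Complex_Main
begin

definition trilinear :: "('a::real_vector \<Rightarrow> 'a \<Rightarrow> 'a \<Rightarrow> 'a) \<Rightarrow> bool" where
  "trilinear br \<longleftrightarrow>
     (\<forall>y z. linear (\<lambda>x. br x y z)) \<and>
     (\<forall>x z. linear (\<lambda>y. br x y z)) \<and>
     (\<forall>x y. linear (\<lambda>z. br x y z))"

text \<open>The underlying vector space is the whole type \<open>'a\<close>. The maps \<open>\<alpha>\<close> and \<open>\<beta>\<close>
  need not be invertible, so skew-symmetry is required only for arguments of the form
  \<open>\<beta> x, \<beta> y, \<alpha> z\<close>.\<close>

locale three_Bihom_Lie_algebra =
  fixes br :: "'a::real_vector \<Rightarrow> 'a \<Rightarrow> 'a \<Rightarrow> 'a"
    and \<alpha> :: "'a \<Rightarrow> 'a"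
    and \<beta> :: "'a \<Rightarrow> 'a"
  assumes trilinear_br: "trilinear br"
    and linear_alpha: "linear \<alpha>"
    and linear_beta: "linear \<beta>"
    and alpha_beta_commute: "\<alpha> \<circ> \<beta> = \<beta> \<circ> \<alpha>"
    and alpha_br: "\<alpha> (br x y z) = br (\<alpha> x) (\<alpha> y) (\<alpha> z)"
    and beta_br: "\<beta> (br x y z) = br (\<beta> x) (\<beta> y) (\<beta> z)"
    and skew_12: "br (\<beta> x) (\<beta> y) (\<alpha> z) = - br (\<beta> y) (\<beta> x) (\<alpha> z)"
    and skew_23: "br (\<beta> x) (\<beta> y) (\<alpha> z) = - br (\<beta> x) (\<beta> z) (\<alpha> y)"
    and Bihom_Jacobi:
      "br (\<beta> (\<beta> u)) (\<beta> (\<beta> v)) (br (\<beta> x) (\<beta> y) (\<alpha> z)) =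
         br (\<beta> (\<beta> y)) (\<beta> (\<beta> z)) (br (\<beta> u) (\<beta> v) (\<alpha> x))
         - br (\<beta> (\<beta> x)) (\<beta> (\<beta> z)) (br (\<beta> u) (\<beta> v) (\<alpha> y))
         + br (\<beta> (\<beta> x)) (\<beta> (\<beta> y)) (br (\<beta> u) (\<beta> v) (\<alpha> z))"

definition almost_complex_structure ::
    "('a::real_vector \<Rightarrow> 'a) \<Rightarrow> ('a \<Rightarrow> 'a) \<Rightarrow> ('a \<Rightarrow> 'a) \<Rightarrow> bool" where
  "almost_complex_structure \<alpha> \<beta> J \<longleftrightarrow>
     linear J \<and> J \<circ> J = (\<lambda>x. - x) \<and> J \<circ> \<alpha> = \<alpha> \<circ> J \<and> J \<circ> \<beta> = \<beta> \<circ> J"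

definition complex_structure ::
    "('a::real_vector \<Rightarrow> 'a \<Rightarrow> 'a \<Rightarrow> 'a) \<Rightarrow> ('a \<Rightarrow> 'a) \<Rightarrow> ('a \<Rightarrow> 'a) \<Rightarrow> ('a \<Rightarrow> 'a) \<Rightarrow> bool" where
  "complex_structure br \<alpha> \<beta> J \<longleftrightarrow>
     almost_complex_structure \<alpha> \<beta> J \<and>
     (\<forall>x y z. J (br x y z) =
        - br (J x) (J y) (J z)
        + br (J x) y z + br x (J y) z + br x y (J z)
        + J (br (J x) (J y) z) + J (br x (J y) (J z)) + J (br (J x) y (J z)))"

end

theory Submission
  imports Defs
begin

text \<open>Moving \<open>J\<close> inside the bracket and using \<open>J\<^sup>2 = -Id\<close> gives
  \<open>J [Jx, Jy, z] = - [x, y, Jz]\<close> and its two analogues, so the six extra terms in the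
  integrability condition cancel in pairs.\<close>

theorem proposition4p18:
  fixes br :: "'a::real_vector \<Rightarrow> 'a \<Rightarrow> 'a \<Rightarrow> 'a"
    and \<alpha> \<beta> J :: "'a \<Rightarrow> 'a"
  assumes "three_Bihom_Lie_algebra br \<alpha> \<beta>"
    and "almost_complex_structure \<alpha> \<beta> J"
    and "\<forall>x y z. J (br x y z) = - br (J x) (J y) (J z)"
  shows "complex_structure br \<alpha> \<beta> J"
proof -
  from assms(1) have tri: "trilinear br"
    by (rule three_Bihom_Lie_algebra.trilinear_br)
  \<comment> \<open>Squaring \<open>J\<close> leaves minus signs inside the slots; linearity in each
    slot pulls them out. The explicit abstractions select the slot in which
    \<open>linear_neg\<close> is applied.\<close>
  have neg: "br (- x) y z = - br x y z" "br x (- y) z = - br x y z" "br x y (- z) = - br x y z"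
    for x y z
    using tri linear_neg[of "\<lambda>x. br x y z" x] linear_neg[of "\<lambda>y. br x y z" y]
      linear_neg[of "\<lambda>z. br x y z" z]
    unfolding trilinear_def by blast+
  have JJ: "J (J x) = - x" for x
    using assms(2) unfolding almost_complex_structure_def by (metis comp_apply)
  have J_br: "J (br x y z) = - br (J x) (J y) (J z)" for x y z
    using assms(3) by blast
  \<comment> \<open>As a rewrite rule, \<open>J_br\<close> pushes \<open>J\<close> inwards. In
    \<open>J (br (J x) (J y) z)\<close> two slots then carry \<open>J\<close> twice; their two signs
    cancel, and the minus of \<open>J_br\<close> remains.\<close>
  show ?thesis
    unfolding complex_structure_def using assms(2) by (simp add: J_br JJ neg)
qed

end
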